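(* Let $p,t$ be positive integers and let $n_1,\dots,n_p$ and $k_1,\dots,k_p$ be positive integers with $k_i\le n_i$ for all $i\in[p]$. Let $X=[n]$ with $n=n_1+\cdots+n_p$, partitioned into consecutive blocks $X_1=[n_1]$ and $X_i=\left[\sum_{j\le i}n_j\right]\setminus\left[\sum_{j\le i-1}n_j\right]$ for $i=2,\dots,p$, and put $k=k_1+\cdots+k_p$ and $$\mathcal{H}_1=\left\{F\in\binom{X}{k}:|F\cap X_i|=k_i,\ i=1,\dots,p\right\}.$$ Suppose $\mathcal{F}\subset\mathcal{H}_1$ is $t$-intersecting, i.e. $|A\cap B|\ge t$ for all $A,B\in\mathcal{F}$. If $n_i>2(t+1)pk_i^2$ for every $i\in[p]$, then $$|\mathcal{F}|\le\max_{\substack{t_1+\cdots+t_p=t\\ t_1,\dots,t_p\in\mathbb{N}}}\prod_{i\in[p]}\binom{n_i-t_i}{k_i-t_i}.$$ Moreover, equality holds if and only if $\mathcal{F}=\{F\in\mathcal{H}_1: T\subset F\}$ for some $T\in\binom{X}{t}$ such that $$\frac{k_i-|T\cap X_i|}{n_i-|T\cap X_i|}\le\frac{k_j-|T\cap X_j|+1}{n_j-|T\cap X_j|+1}$$ for every $i\in[p]$ and every $j\in[p]$ with $|T\cap X_j|\ge1$.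
   Context: $\mathbb{N}$ denotes the non-negative integers; $\binom{a}{b}=0$ when $b<0$ or $b>a$. $\binom{X}{m}$ denotes the family of all $m$-element subsets of $X$, and $[m]=\{1,\dots,m\}$. *)

theory Defs
  imports Complex_Main "HOL-Library.FuncSet" "HOL-Library.Ramsey"
begin

text \<open>Binomial coefficient with the convention that it vanishes for \<open>b < 0\<close> and for \<open>b > a\<close>.
  The arguments are integers because truncated subtraction on \<^typ>\<open>nat\<close> would turn
  \<open>k - t\<close> with \<open>k < t\<close> into 0 and hence the coefficient into 1.\<close>

definition binom :: "int \<Rightarrow> int \<Rightarrow> nat" where
  "binom a b = (if 0 \<le> b \<and> b \<le> a then nat a choose nat b else 0)"

definition ground :: "nat \<Rightarrow> (nat \<Rightarrow> nat) \<Rightarrow> nat set" where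
  "ground p n = {1..(\<Sum>i=1..p. n i)}"

definition block :: "(nat \<Rightarrow> nat) \<Rightarrow> nat \<Rightarrow> nat set" where
  "block n i = {1..(\<Sum>j=1..i. n j)} - {1..(\<Sum>j=1..<i. n j)}"

definition H1 :: "nat \<Rightarrow> (nat \<Rightarrow> nat) \<Rightarrow> (nat \<Rightarrow> nat) \<Rightarrow> nat set set" where
  "H1 p n k = {F \<in> nsets (ground p n) (\<Sum>i=1..p. k i).
                 \<forall>i\<in>{1..p}. card (F \<inter> block n i) = k i}"

definition t_intersecting :: "nat \<Rightarrow> 'a set set \<Rightarrow> bool" where
  "t_intersecting t \<F> \<longleftrightarrow> (\<forall>A\<in>\<F>. \<forall>B\<in>\<F>. t \<le> card (A \<inter> B))"

definition compositions :: "nat \<Rightarrow> nat \<Rightarrow> (nat \<Rightarrow> nat) set" where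
  "compositions p t = {\<tau> \<in> {1..p} \<rightarrow>\<^sub>E UNIV. (\<Sum>i=1..p. \<tau> i) = t}"

definition max_bound :: "nat \<Rightarrow> nat \<Rightarrow> (nat \<Rightarrow> nat) \<Rightarrow> (nat \<Rightarrow> nat) \<Rightarrow> nat" where
  "max_bound p t n k =
     (MAX \<tau>\<in>compositions p t. \<Prod>i=1..p. binom (int (n i) - int (\<tau> i)) (int (k i) - int (\<tau> i)))"

end

theory Submission
  imports Defs "HOL-Library.Disjoint_Sets"
begin

text \<open>Call \<open>S\<close> a cover if it meets every member of \<open>\<F>\<close> in at least \<open>t\<close> points, and let \<open>S\<close> be a
  cover of minimum size \<open>t + m\<close>. If \<open>m = 0\<close>, every member contains \<open>S\<close> and \<open>\<F>\<close> lies in a star.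
  Otherwise, a set \<open>U\<close> with fewer than \<open>t + m\<close> points meets some member \<open>G\<close> in fewer than \<open>t\<close> points,
  so every member above \<open>U\<close> contains a further point of \<open>G\<close>; since \<open>n i > 2 (t + 1) p (k i)\<^sup>2\<close>, the
  sizes of the stars of \<open>U \<union> {x}\<close>, \<open>x \<in> G - U\<close>, add up to at most \<open>1 / (2 (t + 1))\<close> times that of the
  star of \<open>U\<close>. Starting from the \<open>t\<close>-subsets of \<open>S\<close> and iterating \<open>m\<close> times bounds \<open>|\<F>|\<close> by
  \<open>((t + m) choose m) / (2 (t + 1)) ^ m \<le> 1 / 2\<close> times the maximum.

  For the equality case, raising \<open>\<tau> i\<close> by one multiplies the star size by \<open>(k i - \<tau> i) / (n i - \<tau> i)\<close>,
  which decreases in \<open>\<tau> i\<close>. By this log-concavity a composition is optimal as soon as no exchange of a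
  single unit between two blocks improves it, which is the stated inequality.\<close>

section \<open>Counting sets through their traces on the blocks\<close>

lemma card_supersets_of_size:
  assumes "finite X" "U \<subseteq> X"
  shows "card {A. A \<subseteq> X \<and> U \<subseteq> A \<and> card A = k} = binom (int (card X) - int (card U)) (int k - int (card U))"
proof (cases "card U \<le> k")
  case True
  have fU: "finite U" using assms finite_subset by blast
  have "bij_betw (\<lambda>A. A - U) {A. A \<subseteq> X \<and> U \<subseteq> A \<and> card A = k} {B. B \<subseteq> X - U \<and> card B = k - card U}"
  proof (rule bij_betw_byWitness[where f' = "\<lambda>B. B \<union> U"])
    show "(\<lambda>B. B \<union> U) ` {B. B \<subseteq> X - U \<and> card B = k - card U} \<subseteq> {A. A \<subseteq> X \<and> U \<subseteq> A \<and> card A = k}"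
    proof clarsimp
      fix B assume B: "B \<subseteq> X - U" "card B = k - card U"
      have "card (B \<union> U) = card B + card U"
        using B fU assms by (intro card_Un_disjoint) (auto intro: finite_subset)
      then show "B \<subseteq> X \<and> U \<subseteq> X \<and> card (B \<union> U) = k" using B True assms by auto
    qed
  qed (use fU in \<open>auto simp: card_Diff_subset\<close>)
  then have "card {A. A \<subseteq> X \<and> U \<subseteq> A \<and> card A = k} = card {B. B \<subseteq> X - U \<and> card B = k - card U}"
    by (rule bij_betw_same_card)
  also have "\<dots> = (card X - card U) choose (k - card U)"
    using assms fU by (simp add: n_subsets card_Diff_subset)
  also have "\<dots> = binom (int (card X) - int (card U)) (int k - int (card U))"
    using True card_mono[OF assms] by (auto simp: binom_def nat_diff_distrib of_nat_diff[symmetric] binomial_eq_0 simp del: of_nat_diff)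
  finally show ?thesis .
next
  case False
  then have "{A. A \<subseteq> X \<and> U \<subseteq> A \<and> card A = k} = {}"
    using assms by (auto dest: card_mono[rotated] intro: finite_subset)
  then have "card {A. A \<subseteq> X \<and> U \<subseteq> A \<and> card A = k} = 0" by (simp only: card.empty)
  then show ?thesis using False by (simp add: binom_def)
qed

lemma Union_Int_disjoint_family:
  assumes disj: "disjoint_family_on X I" and i: "i \<in> I" and sub: "\<And>j. j \<in> I \<Longrightarrow> f j \<subseteq> X j"
  shows "(\<Union>j\<in>I. f j) \<inter> X i = f i"
proof
  show "(\<Union>j\<in>I. f j) \<inter> X i \<subseteq> f i"
  proof
    fix x assume "x \<in> (\<Union>j\<in>I. f j) \<inter> X i"
    then obtain j where j: "j \<in> I" "x \<in> f j" "x \<in> X i" by blast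
    then have "x \<in> X j" using sub by blast
    then have "j = i" using disj j i unfolding disjoint_family_on_def by blast
    then show "x \<in> f i" using j by simp
  qed
qed (use i sub in blast)

text \<open>A subset of a disjoint union is determined by its traces, and these can be chosen
  independently; hence the product.\<close>

lemma card_blockwise:
  assumes fin: "finite I" and disj: "disjoint_family_on X I"
  shows "card {F. F \<subseteq> (\<Union>i\<in>I. X i) \<and> (\<forall>i\<in>I. P i (F \<inter> X i))} = (\<Prod>i\<in>I. card {A. A \<subseteq> X i \<and> P i A})"
proof -
  note cut = Union_Int_disjoint_family[OF disj]
  have "bij_betw (\<lambda>F. \<lambda>i\<in>I. F \<inter> X i) {F. F \<subseteq> (\<Union>i\<in>I. X i) \<and> (\<forall>i\<in>I. P i (F \<inter> X i))}
      (\<Pi>\<^sub>E i\<in>I. {A. A \<subseteq> X i \<and> P i A})"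
  proof (rule bij_betw_byWitness[where f' = "\<lambda>f. \<Union>i\<in>I. f i"])
    show "\<forall>f\<in>(\<Pi>\<^sub>E i\<in>I. {A. A \<subseteq> X i \<and> P i A}). (\<lambda>i\<in>I. (\<Union>j\<in>I. f j) \<inter> X i) = f"
    proof
      fix f assume f: "f \<in> (\<Pi>\<^sub>E i\<in>I. {A. A \<subseteq> X i \<and> P i A})"
      show "(\<lambda>i\<in>I. (\<Union>j\<in>I. f j) \<inter> X i) = f"
      proof
        fix i show "(\<lambda>i\<in>I. (\<Union>j\<in>I. f j) \<inter> X i) i = f i"
        proof (cases "i \<in> I")
          case True
          then show ?thesis using f by (simp add: cut PiE_iff)
        next
          case False
          then show ?thesis using f by (simp add: PiE_iff extensional_def)
        qed
      qed
    qed
    show "(\<lambda>f. \<Union>i\<in>I. f i) ` (\<Pi>\<^sub>E i\<in>I. {A. A \<subseteq> X i \<and> P i A})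
        \<subseteq> {F. F \<subseteq> (\<Union>i\<in>I. X i) \<and> (\<forall>i\<in>I. P i (F \<inter> X i))}"
      by (force simp: cut PiE_iff)
  qed auto
  from bij_betw_same_card[OF this] show ?thesis by (simp only: card_PiE[OF fin])
qed

lemma block_eq: "block n i = {(\<Sum>j=1..<i. n j)<..(\<Sum>j=1..i. n j)}"
  by (auto simp: block_def)

lemma sum_atMost_le_sum_lessThan:
  fixes n :: "nat \<Rightarrow> nat"
  assumes "i < j"
  shows "(\<Sum>l=1..i. n l) \<le> (\<Sum>l=1..<j. n l)"
  by (rule sum_mono2) (use assms in auto)

lemma disjoint_block: "disjoint_family_on (block n) I"
  unfolding disjoint_family_on_def
proof (intro ballI impI)
  fix i j :: nat assume "i \<noteq> j"
  then show "block n i \<inter> block n j = {}"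
    using sum_atMost_le_sum_lessThan[of i j n] sum_atMost_le_sum_lessThan[of j i n]
    by (fastforce simp: block_eq neq_iff)
qed

lemma finite_block [simp]: "finite (block n i)"
  by (simp add: block_eq)

lemma finite_ground [simp]: "finite (ground p n)"
  by (simp add: ground_def)

lemma card_block: "1 \<le> i \<Longrightarrow> card (block n i) = n i"
  by (cases i) (simp_all add: block_eq atLeastLessThanSuc_atLeastAtMost)

lemma ground_eq_Union_block: "ground p n = (\<Union>i\<in>{1..p}. block n i)"
proof (induction p)
  case 0
  then show ?case by (simp add: ground_def)
next
  case (Suc p)
  have "ground (Suc p) n = ground p n \<union> block n (Suc p)"
    by (auto simp: ground_def block_eq atLeastLessThanSuc_atLeastAtMost)
  then show ?case using Suc by (auto simp: atLeastAtMostSuc_conv)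
qed

lemma card_eq_sum_blocks:
  assumes "U \<subseteq> ground p n"
  shows "card U = (\<Sum>i=1..p. card (U \<inter> block n i))"
proof -
  have "U = (\<Union>i\<in>{1..p}. U \<inter> block n i)"
    using assms by (auto simp: ground_eq_Union_block)
  then have "card U = card (\<Union>i\<in>{1..p}. U \<inter> block n i)" by simp
  also have "\<dots> = (\<Sum>i=1..p. card (U \<inter> block n i))"
    using disjoint_block[of n "{1..p}"]
    by (intro card_UN_disjoint) (auto simp: disjoint_family_on_def)
  finally show ?thesis .
qed

lemma H1_eq: "H1 p n k = {F. F \<subseteq> ground p n \<and> (\<forall>i\<in>{1..p}. card (F \<inter> block n i) = k i)}"
  by (auto simp: H1_def nsets_def card_eq_sum_blocks intro: finite_subset[OF _ finite_ground])

lemma finite_H1 [simp]: "finite (H1 p n k)"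
  by (rule finite_subset[of _ "Pow (ground p n)"]) (auto simp: H1_eq)

section \<open>Star sizes and their maximum over compositions\<close>

text \<open>Takes arbitrary functions, not only extensional compositions, so that profiles of sets
  and pointwise updates can be inserted directly.\<close>

definition block_weight :: "nat \<Rightarrow> (nat \<Rightarrow> nat) \<Rightarrow> (nat \<Rightarrow> nat) \<Rightarrow> (nat \<Rightarrow> nat) \<Rightarrow> nat" where
  "block_weight p n k \<tau> = (\<Prod>i=1..p. binom (int (n i) - int (\<tau> i)) (int (k i) - int (\<tau> i)))"

definition profile :: "(nat \<Rightarrow> nat) \<Rightarrow> nat set \<Rightarrow> nat \<Rightarrow> nat" where
  "profile n U i = card (U \<inter> block n i)"

lemma card_star:
  assumes "U \<subseteq> ground p n"
  shows "card {F \<in> H1 p n k. U \<subseteq> F} = block_weight p n k (profile n U)"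
proof -
  have "{F \<in> H1 p n k. U \<subseteq> F} = {F. F \<subseteq> (\<Union>i\<in>{1..p}. block n i) \<and>
      (\<forall>i\<in>{1..p}. U \<inter> block n i \<subseteq> F \<inter> block n i \<and> card (F \<inter> block n i) = k i)}"
    using assms by (auto simp: H1_eq ground_eq_Union_block)
  then have "card {F \<in> H1 p n k. U \<subseteq> F} =
      (\<Prod>i=1..p. card {A. A \<subseteq> block n i \<and> U \<inter> block n i \<subseteq> A \<and> card A = k i})"
    using card_blockwise[OF _ disjoint_block, of "{1..p}" n "\<lambda>i A. U \<inter> block n i \<subseteq> A \<and> card A = k i"]
    by simp
  also have "\<dots> = block_weight p n k (profile n U)"
    unfolding block_weight_def profile_def
    by (rule prod.cong) (auto simp: card_supersets_of_size card_block)
  finally show ?thesis .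
qed

lemma block_weight_cong:
  "(\<And>i. i \<in> {1..p} \<Longrightarrow> \<tau> i = \<sigma> i) \<Longrightarrow> block_weight p n k \<tau> = block_weight p n k \<sigma>"
  by (simp add: block_weight_def)

lemma compositions_bounded:
  assumes "\<tau> \<in> compositions p t" "i \<in> {1..p}"
  shows "\<tau> i \<le> t"
  using assms member_le_sum[of i "{1..p}" \<tau>] by (auto simp: compositions_def)

lemma finite_compositions: "finite (compositions p t)"
proof (rule finite_subset)
  show "compositions p t \<subseteq> {1..p} \<rightarrow>\<^sub>E {..t}"
  proof
    fix \<tau> assume \<tau>: "\<tau> \<in> compositions p t"
    then have "\<tau> \<in> extensional {1..p}" by (simp add: compositions_def PiE_iff)
    then show "\<tau> \<in> {1..p} \<rightarrow>\<^sub>E {..t}" using compositions_bounded[OF \<tau>] by (simp add: PiE_iff)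
  qed
qed (intro finite_PiE; simp)

lemma restrict_in_compositions: "(\<Sum>i=1..p. \<tau> i) = t \<Longrightarrow> restrict \<tau> {1..p} \<in> compositions p t"
  by (simp add: compositions_def)

text \<open>Members of \<open>compositions\<close> are extensional, so \<open>\<tau>\<close> is
  first restricted to \<open>{1..p}\<close>, the only place where the weight reads it.\<close>

lemma block_weight_le_max_bound:
  assumes "(\<Sum>i=1..p. \<tau> i) = t"
  shows "block_weight p n k \<tau> \<le> max_bound p t n k"
proof -
  have "block_weight p n k \<tau> = block_weight p n k (restrict \<tau> {1..p})"
    by (rule block_weight_cong) simp
  also have "\<dots> \<le> max_bound p t n k"
    unfolding max_bound_def block_weight_def[symmetric]
    using restrict_in_compositions[OF assms] finite_compositions by (intro Max_ge) auto
  finally show ?thesis .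
qed

lemma max_bound_attained:
  assumes "(\<Sum>i=1..p. \<tau> i) = t"
  obtains \<sigma> where "(\<Sum>i=1..p. \<sigma> i) = t" "max_bound p t n k = block_weight p n k \<sigma>"
proof -
  have "max_bound p t n k \<in> block_weight p n k ` compositions p t"
    unfolding max_bound_def block_weight_def[symmetric]
    using restrict_in_compositions[OF assms] finite_compositions by (intro Max_in) auto
  then show thesis using that by (auto simp: compositions_def)
qed

lemma sum_profile: "U \<subseteq> ground p n \<Longrightarrow> (\<Sum>i=1..p. profile n U i) = card U"
  by (simp add: profile_def card_eq_sum_blocks)

section \<open>Optimal compositions\<close>

text \<open>The ratio of consecutive block factors, at \<open>s + 1\<close> and at \<open>s\<close>.
  Subtraction is in the reals: for \<open>K < s < N\<close> the value is negative.\<close>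

definition density :: "nat \<Rightarrow> nat \<Rightarrow> nat \<Rightarrow> real" where
  "density N K s = (real K - real s) / (real N - real s)"

lemma binom_step:
  assumes "s < N"
  shows "real (binom (int N - int (Suc s)) (int K - int (Suc s)))
    = density N K s * real (binom (int N - int s) (int K - int s))"
proof (cases "s < K \<and> K \<le> N")
  case True
  define a b where "a = N - Suc s" and "b = K - Suc s"
  have ab: "N = a + Suc s" "K = b + Suc s" "b \<le> a" using True by (auto simp: a_def b_def)
  have "real (Suc b) * real (Suc a choose Suc b) = real (Suc a) * real (a choose b)"
    using Suc_times_binomial[of b a] by (metis of_nat_mult)
  moreover have "nat (1 + int a) = Suc a" "nat (1 + int b) = Suc b" by auto
  ultimately show ?thesis using ab(3)
    by (simp add: ab(1,2) binom_def density_def field_simps del: binomial_Suc_Suc)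
next
  case False
  \<comment> \<open>Both sides vanish: for \<open>s = K\<close> the density is 0, otherwise the
    binomial on the right is.\<close>
  then show ?thesis using assms by (auto simp: binom_def density_def)
qed

text \<open>The density is 1 minus the nonnegative constant \<open>N - K\<close> divided by
  \<open>N - s\<close>, and this denominator decreases in \<open>s\<close>.\<close>

lemma density_antimono:
  assumes "K \<le> N" "s \<le> s'" "s' < N"
  shows "density N K s' \<le> density N K s"
proof -
  have "density N K r = 1 - (real N - real K) / (real N - real r)" if "r < N" for r
    using that by (simp add: density_def field_simps)
  moreover have "(real N - real K) / (real N - real s) \<le> (real N - real K) / (real N - real s')"
    using assms by (intro divide_left_mono mult_pos_pos) auto
  ultimately show ?thesis using assms by simp
qed

lemma block_weight_increment:
  assumes "i \<in> {1..p}" "\<tau> i < n i"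
  shows "real (block_weight p n k (\<tau>(i := Suc (\<tau> i)))) = density (n i) (k i) (\<tau> i) * real (block_weight p n k \<tau>)"
proof -
  let ?b = "\<lambda>\<tau> j. binom (int (n j) - int (\<tau> j)) (int (k j) - int (\<tau> j))"
  have "block_weight p n k \<sigma> = ?b \<sigma> i * (\<Prod>j\<in>{1..p}-{i}. ?b \<sigma> j)" for \<sigma>
    unfolding block_weight_def using assms(1) by (subst prod.remove[of _ i]) auto
  moreover have "(\<Prod>j\<in>{1..p}-{i}. ?b (\<tau>(i := Suc (\<tau> i))) j) = (\<Prod>j\<in>{1..p}-{i}. ?b \<tau> j)"
    by (rule prod.cong) auto
  ultimately show ?thesis using binom_step[OF assms(2), of "k i"] by simp
qed

text \<open>Local optimality: moving one unit from block \<open>j\<close> to another block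
  \<open>i\<close> changes the weight by the ratio of these two densities. The guard
  \<open>1 \<le> \<tau> j\<close> prevents truncation in \<open>\<tau> j - 1\<close>.\<close>

definition balanced :: "nat \<Rightarrow> (nat \<Rightarrow> nat) \<Rightarrow> (nat \<Rightarrow> nat) \<Rightarrow> (nat \<Rightarrow> nat) \<Rightarrow> bool" where
  "balanced p n k \<tau> \<longleftrightarrow> (\<forall>i\<in>{1..p}. \<forall>j\<in>{1..p}. 1 \<le> \<tau> j \<longrightarrow>
     density (n i) (k i) (\<tau> i) \<le> density (n j) (k j) (\<tau> j - 1))"

text \<open>Greedy construction: each new unit goes to a block of currently largest density.\<close>

lemma balanced_exists:
  assumes "1 \<le> p" "\<And>i. i \<in> {1..p} \<Longrightarrow> k i \<le> n i" "\<And>i. i \<in> {1..p} \<Longrightarrow> t < n i"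
  shows "\<exists>\<tau>. (\<Sum>i=1..p. \<tau> i) = t \<and> balanced p n k \<tau>"
  using assms(3)
proof (induction t)
  case 0
  show ?case by (rule exI[of _ "\<lambda>_. 0"]) (simp add: balanced_def)
next
  case (Suc t)
  then obtain \<tau> where \<tau>: "(\<Sum>i=1..p. \<tau> i) = t" "balanced p n k \<tau>"
    using Suc_lessD by blast
  let ?d = "\<lambda>i. density (n i) (k i) (\<tau> i)"
  have "Max (?d ` {1..p}) \<in> ?d ` {1..p}"
    using assms(1) by (intro Max_in) auto
  then obtain m where m_max: "Max (?d ` {1..p}) = ?d m" and "m \<in> {1..p}"
    by (rule imageE)
  have m: "m \<in> {1..p}" "\<And>i. i \<in> {1..p} \<Longrightarrow> ?d i \<le> ?d m"
    unfolding m_max[symmetric] by fact (intro Max_ge; simp)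
  define \<sigma> where "\<sigma> = \<tau>(m := Suc (\<tau> m))"
  have "(\<Sum>i=1..p. \<sigma> i) = \<sigma> m + (\<Sum>i\<in>{1..p}-{m}. \<tau> i)"
    unfolding \<sigma>_def using m(1) by (subst sum.remove[of _ m]) auto
  also have "\<dots> = Suc (\<tau> m + (\<Sum>i\<in>{1..p}-{m}. \<tau> i))" by (simp add: \<sigma>_def)
  also have "\<tau> m + (\<Sum>i\<in>{1..p}-{m}. \<tau> i) = t"
    using m(1) \<tau>(1) by (metis sum.remove finite_atLeastAtMost)
  finally have sum: "(\<Sum>i=1..p. \<sigma> i) = Suc t" .
  have dec: "density (n i) (k i) (\<sigma> i) \<le> ?d i" if i: "i \<in> {1..p}" for i
  proof (rule density_antimono)
    show "\<sigma> i < n i" using member_le_sum[of i "{1..p}" \<sigma>] sum Suc.prems[OF i] i by auto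
  qed (use assms(2)[OF i] in \<open>auto simp: \<sigma>_def\<close>)
  have "balanced p n k \<sigma>"
    unfolding balanced_def
  proof (intro ballI impI)
    fix i j assume ij: "i \<in> {1..p}" "j \<in> {1..p}" "1 \<le> \<sigma> j"
    show "density (n i) (k i) (\<sigma> i) \<le> density (n j) (k j) (\<sigma> j - 1)"
    proof (cases "j = m")
      case True
      \<comment> \<open>Here \<open>\<sigma> j - 1 = \<tau> m\<close>, where the density is largest
        by the choice of \<open>m\<close>.\<close>
      then show ?thesis using dec[OF ij(1)] m(2)[OF ij(1)] by (simp add: \<sigma>_def)
    next
      case False
      then have "\<sigma> j = \<tau> j" by (simp add: \<sigma>_def)
      \<comment> \<open>The right-hand side is that of \<open>\<tau>\<close>, and the left-hand side
        can only have dropped.\<close>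
      then show ?thesis using dec[OF ij(1)] \<tau>(2) ij unfolding balanced_def by (smt (verit))
    qed
  qed
  with sum show ?case by blast
qed

text \<open>If \<open>\<theta>\<close> separates the ratios of consecutive values of \<open>b\<close> before and after \<open>\<tau>\<close>, then
  \<open>b \<sigma> / \<theta> ^ \<sigma>\<close> is largest at \<open>\<sigma> = \<tau>\<close>.\<close>

lemma ratio_threshold:
  fixes b :: "nat \<Rightarrow> real"
  assumes pos: "0 < \<theta>"
    and after: "\<And>s. \<tau> \<le> s \<Longrightarrow> s < \<sigma> \<Longrightarrow> b (Suc s) \<le> \<theta> * b s"
    and before: "\<And>s. s < \<tau> \<Longrightarrow> \<theta> * b s \<le> b (Suc s)"
  shows "b \<sigma> * \<theta> ^ \<tau> \<le> b \<tau> * \<theta> ^ \<sigma>"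
proof (cases "\<tau> \<le> \<sigma>")
  case True
  then show ?thesis using after
  proof (induction \<sigma> rule: dec_induct)
    case base
    show ?case by simp
  next
    case (step m)
    have "b (Suc m) * \<theta> ^ \<tau> \<le> (\<theta> * b m) * \<theta> ^ \<tau>"
      using step pos by (intro mult_right_mono) auto
    also have "\<dots> \<le> \<theta> * (b \<tau> * \<theta> ^ m)"
      using step pos by (auto simp: mult.assoc)
    finally show ?case by (simp add: mult_ac)
  qed
next
  case False
  then have "\<sigma> \<le> \<tau>" by simp
  then show ?thesis
  proof (induction \<sigma> rule: inc_induct)
    case base
    show ?case by simp
  next
    case (step m)
    have "\<theta> * (b m * \<theta> ^ \<tau>) \<le> b (Suc m) * \<theta> ^ \<tau>"
      using before[of m] step pos by (simp add: mult.assoc[symmetric])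
    also have "\<dots> \<le> \<theta> * (b \<tau> * \<theta> ^ m)" using step by (simp add: mult_ac)
    finally show ?case using pos by simp
  qed
qed

text \<open>Local optimality implies global optimality: one threshold \<open>\<theta>\<close>
  separates the densities before and after \<open>\<tau>\<close> in all blocks at once, so
  \<open>ratio_threshold\<close> applies blockwise. The powers of \<open>\<theta>\<close> cancel
  because both compositions sum to \<open>t\<close>.\<close>

lemma balanced_block_weight_max:
  assumes "1 \<le> p" and kn: "\<And>i. i \<in> {1..p} \<Longrightarrow> k i \<le> n i" and tn: "\<And>i. i \<in> {1..p} \<Longrightarrow> t < n i"
    and \<tau>: "(\<Sum>i=1..p. \<tau> i) = t" "balanced p n k \<tau>" and \<sigma>: "(\<Sum>i=1..p. \<sigma> i) = t"
  shows "block_weight p n k \<sigma> \<le> block_weight p n k \<tau>"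
proof -
  define \<theta> where "\<theta> = Max ((\<lambda>i. density (n i) (k i) (\<tau> i)) ` {1..p})"
  have lower: "density (n i) (k i) (\<tau> i) \<le> \<theta>" if "i \<in> {1..p}" for i
    using that unfolding \<theta>_def by (intro Max_ge) auto
  have "\<theta> \<in> (\<lambda>i. density (n i) (k i) (\<tau> i)) ` {1..p}"
    unfolding \<theta>_def using assms(1) by (intro Max_in) auto
  then have upper: "\<theta> \<le> density (n j) (k j) (\<tau> j - 1)" if "j \<in> {1..p}" "1 \<le> \<tau> j" for j
    using \<tau>(2) that unfolding balanced_def by blast
  have \<tau>t: "\<tau> i < n i" if "i \<in> {1..p}" for i
    using member_le_sum[of i "{1..p}" \<tau>] \<tau>(1) tn[OF that] that by auto
  have \<sigma>t: "\<sigma> i < n i" if "i \<in> {1..p}" for i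
    using member_le_sum[of i "{1..p}" \<sigma>] \<sigma> tn[OF that] that by auto
  show ?thesis
  proof (cases "0 < \<theta>")
    case True
    define b where "b = (\<lambda>i s. real (binom (int (n i) - int s) (int (k i) - int s)))"
    have bw: "real (block_weight p n k \<rho>) = (\<Prod>i=1..p. b i (\<rho> i))" for \<rho>
      by (simp add: block_weight_def b_def)
    have b: "b i (\<sigma> i) * \<theta> ^ \<tau> i \<le> b i (\<tau> i) * \<theta> ^ \<sigma> i" if i: "i \<in> {1..p}" for i
    proof (rule ratio_threshold[OF True])
      fix s assume s: "\<tau> i \<le> s" "s < \<sigma> i"
      have "density (n i) (k i) s \<le> \<theta>"
        using density_antimono[OF kn[OF i] s(1)] lower[OF i] s \<sigma>t[OF i] by simp
      then show "b i (Suc s) \<le> \<theta> * b i s"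
        using s \<sigma>t[OF i] by (simp only: b_def, subst binom_step) (auto intro: mult_right_mono)
    next
      fix s assume s: "s < \<tau> i"
      have "\<theta> \<le> density (n i) (k i) s"
        using density_antimono[OF kn[OF i], of s "\<tau> i - 1"] upper[OF i] s \<tau>t[OF i] by linarith
      then show "\<theta> * b i s \<le> b i (Suc s)"
        using s \<tau>t[OF i] by (simp only: b_def, subst binom_step) (auto intro: mult_right_mono)
    qed
    have "real (block_weight p n k \<sigma>) * \<theta> ^ t = (\<Prod>i=1..p. b i (\<sigma> i) * \<theta> ^ \<tau> i)"
      by (simp add: bw prod.distrib power_sum \<tau>(1)[symmetric])
    also have "\<dots> \<le> (\<Prod>i=1..p. b i (\<tau> i) * \<theta> ^ \<sigma> i)"
      using b True by (intro prod_mono) (auto simp: b_def)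
    also have "\<dots> = real (block_weight p n k \<tau>) * \<theta> ^ t"
      by (simp add: bw prod.distrib power_sum \<sigma>[symmetric])
    finally show ?thesis using True by simp
  next
    case False
    \<comment> \<open>With \<open>\<theta> \<le> 0\<close> there is no usable threshold, but then
      every block is exhausted by \<open>\<tau>\<close>.\<close>
    have k\<tau>: "k i \<le> \<tau> i" if i: "i \<in> {1..p}" for i
    proof (rule ccontr)
      assume "\<not> k i \<le> \<tau> i"
      then have "0 < density (n i) (k i) (\<tau> i)" using \<tau>t[OF i] by (simp add: density_def)
      then show False using lower[OF i] False by simp
    qed
    show ?thesis
    proof (cases "\<exists>i\<in>{1..p}. k i < \<sigma> i")
      case True
      then have "block_weight p n k \<sigma> = 0" by (force simp: block_weight_def binom_def)
      then show ?thesis by simp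
    next
      case False
      \<comment> \<open>Now \<open>\<sigma> i \<le> k i \<le> \<tau> i\<close> in every block, and
        equal sums force equality.\<close>
      then have le: "\<sigma> i \<le> \<tau> i" if "i \<in> {1..p}" for i using k\<tau> that by (meson le_trans not_le)
      have "\<sigma> i = \<tau> i" if i: "i \<in> {1..p}" for i
        using sum_mono_inv[of \<sigma> "{1..p}" \<tau> i] le \<sigma> \<tau>(1) i by simp
      then show ?thesis using block_weight_cong by (metis order_refl)
    qed
  qed
qed

text \<open>A violated inequality names an exchange that strictly increases the weight; positivity
  makes the increase strict.\<close>

lemma block_weight_max_balanced:
  assumes kn: "\<And>i. i \<in> {1..p} \<Longrightarrow> k i \<le> n i" and tn: "\<And>i. i \<in> {1..p} \<Longrightarrow> t < n i"
    and \<tau>: "(\<Sum>i=1..p. \<tau> i) = t" and pos: "0 < block_weight p n k \<tau>"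
    and max: "\<And>\<sigma>. (\<Sum>i=1..p. \<sigma> i) = t \<Longrightarrow> block_weight p n k \<sigma> \<le> block_weight p n k \<tau>"
  shows "balanced p n k \<tau>"
  unfolding balanced_def
proof (intro ballI impI, rule ccontr)
  fix i j assume ij: "i \<in> {1..p}" "j \<in> {1..p}" "1 \<le> \<tau> j"
  let ?di = "density (n i) (k i) (\<tau> i)" and ?dj = "density (n j) (k j) (\<tau> j - 1)"
  assume "\<not> ?di \<le> ?dj"
  then have less: "?dj < ?di" by simp
  have \<tau>t: "\<tau> i < n i" if "i \<in> {1..p}" for i
    using member_le_sum[of i "{1..p}" \<tau>] \<tau> tn[OF that] that by auto
  have "i \<noteq> j" using less density_antimono[OF kn[OF ij(1)], of "\<tau> i - 1" "\<tau> i"] \<tau>t[OF ij(1)] by auto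
  \<comment> \<open>\<open>\<rho>\<close> lies one unit below both \<open>\<tau>\<close> and the
    exchanged \<open>\<sigma>\<close>; comparing both with it avoids dividing by a density.\<close>
  define \<rho> where "\<rho> = \<tau>(j := \<tau> j - 1)"
  define \<sigma> where "\<sigma> = \<rho>(i := Suc (\<rho> i))"
  have \<tau>\<rho>: "\<tau> = \<rho>(j := Suc (\<rho> j))" using ij(3) by (auto simp: \<rho>_def)
  have upd: "(\<Sum>l=1..p. (\<rho>(m := Suc (\<rho> m))) l) = Suc (\<Sum>l=1..p. \<rho> l)" if "m \<in> {1..p}" for m
    using that by (simp add: sum.remove[of _ m])
  have "(\<Sum>l=1..p. \<sigma> l) = t"
    using upd[OF ij(1)] upd[OF ij(2)] \<tau> \<tau>\<rho> by (simp add: \<sigma>_def)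
  then have "block_weight p n k \<sigma> \<le> block_weight p n k \<tau>" by (rule max)
  moreover have "real (block_weight p n k \<sigma>) = ?di * real (block_weight p n k \<rho>)"
    using block_weight_increment[of i p \<rho> n k] ij(1) \<tau>t[OF ij(1)] \<open>i \<noteq> j\<close> by (simp add: \<sigma>_def \<rho>_def)
  moreover have wt: "real (block_weight p n k \<tau>) = ?dj * real (block_weight p n k \<rho>)"
    using block_weight_increment[of j p \<rho> n k] ij(2) \<tau>t[OF ij(2)] by (subst \<tau>\<rho>) (simp add: \<rho>_def)
  moreover have "0 < real (block_weight p n k \<rho>)"
    using pos wt by (cases "block_weight p n k \<rho> = 0") auto
  ultimately show False using less by (metis mult_less_cancel_right_pos not_le of_nat_le_iff)
qed

section \<open>The covering argument for t-intersecting families\<close>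

text \<open>The induction step multiplies by \<open>(t + m + 1) / (m + 1)\<close>, which is at most
  \<open>t + 1\<close>.\<close>

lemma binomial_add_le_power: "(t + m) choose m \<le> (t + 1) ^ m"
proof (induction m)
  case 0
  show ?case by simp
next
  case (Suc m)
  have "Suc m * ((t + Suc m) choose Suc m) = (t + Suc m) * ((t + m) choose m)"
    using Suc_times_binomial[of m "t + m"] by simp
  also have "\<dots> \<le> (Suc m * (t + 1)) * (t + 1) ^ m"
    using Suc by (intro mult_mono) auto
  finally have "Suc m * ((t + Suc m) choose Suc m) \<le> Suc m * (t + 1) ^ Suc m"
    by (simp only: power_Suc mult.assoc)
  then show ?case by (simp only: Suc_mult_le_cancel1)
qed

text \<open>The weight \<open>w\<close> abstracts an upper bound for star sizes. The factor 1/2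
  leaves a gap, so that a nonempty family outside a single star cannot attain
  \<open>M\<close>.\<close>

lemma t_intersecting_trivial_or_small:
  fixes \<F> :: "'a set set" and w :: "'a set \<Rightarrow> real"
  assumes fin: "finite X" and sub: "\<F> \<subseteq> Pow X" and ne: "\<F> \<noteq> {}" and int: "t_intersecting t \<F>"
    and count: "\<And>U. U \<subseteq> X \<Longrightarrow> real (card {F \<in> \<F>. U \<subseteq> F}) \<le> w U"
    and decay: "\<And>U G. U \<subseteq> X \<Longrightarrow> G \<in> \<F> \<Longrightarrow> (\<Sum>x\<in>G - U. w (insert x U)) \<le> w U / (2 * (real t + 1))"
    and bound: "\<And>T. T \<subseteq> X \<Longrightarrow> card T = t \<Longrightarrow> w T \<le> M"
  shows "(\<exists>T\<subseteq>X. card T = t \<and> (\<forall>F\<in>\<F>. T \<subseteq> F)) \<or> real (card \<F>) \<le> M / 2"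
proof -
  define cover where "cover S \<longleftrightarrow> S \<subseteq> X \<and> (\<forall>F\<in>\<F>. t \<le> card (S \<inter> F))" for S
  have finF: "finite \<F>" using fin sub by (meson finite_Pow_iff finite_subset)
  obtain G0 where G0: "G0 \<in> \<F>" using ne by blast
  \<comment> \<open>Any member is a cover, so a minimum cover exists.\<close>
  have "cover G0" using G0 int sub by (auto simp: cover_def t_intersecting_def)
  then obtain S where S: "cover S" and S_min: "\<And>S'. cover S' \<Longrightarrow> card S \<le> card S'"
    using ex_has_least_nat[of cover G0 card] by blast
  have finS: "finite S" using S fin finite_subset by (auto simp: cover_def)
  have tS: "t \<le> card S" using S G0 finS card_mono[of S "S \<inter> G0"] by (fastforce simp: cover_def)
  define m where "m = card S - t"
  have card_S: "card S = t + m" using tS by (simp add: m_def)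
  define \<epsilon> where "\<epsilon> = 1 / (2 * (real t + 1))"
  have \<epsilon>: "0 < \<epsilon>" by (simp add: \<epsilon>_def)
  \<comment> \<open>\<open>j\<close> counts the points that \<open>U\<close> lacks to reach the
    minimum cover size; while \<open>j > 0\<close>, \<open>U\<close> is no cover and one more
    branching step is possible.\<close>
  have shrink: "real (card {F \<in> \<F>. U \<subseteq> F}) \<le> \<epsilon> ^ j * w U"
    if "U \<subseteq> X" "card U + j = card S" for U j
    using that
  proof (induction j arbitrary: U)
    case 0
    then show ?case using count by simp
  next
    case (Suc j)
    have "\<not> cover U" using S_min[of U] Suc.prems by auto
    then obtain G where G: "G \<in> \<F>" "card (U \<inter> G) < t"
      using Suc.prems by (auto simp: cover_def not_le)
    have finG: "finite G" and finU: "finite U" using G(1) sub fin Suc.prems by (auto intro: finite_subset)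
    have "{F \<in> \<F>. U \<subseteq> F} \<subseteq> (\<Union>x\<in>G - U. {F \<in> \<F>. insert x U \<subseteq> F})"
    proof
      fix F assume F: "F \<in> {F \<in> \<F>. U \<subseteq> F}"
      then have "t \<le> card (F \<inter> G)" using G int by (auto simp: t_intersecting_def)
      then have "\<not> F \<inter> G \<subseteq> U \<inter> G" using G(2) card_mono[of "U \<inter> G" "F \<inter> G"] finU by auto
      then show "F \<in> (\<Union>x\<in>G - U. {F \<in> \<F>. insert x U \<subseteq> F})" using F by auto
    qed
    then have "card {F \<in> \<F>. U \<subseteq> F} \<le> card (\<Union>x\<in>G - U. {F \<in> \<F>. insert x U \<subseteq> F})"
      using finG finF by (intro card_mono) auto
    also have "\<dots> \<le> (\<Sum>x\<in>G - U. card {F \<in> \<F>. insert x U \<subseteq> F})"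
      using finG by (intro card_UN_le) auto
    finally have "real (card {F \<in> \<F>. U \<subseteq> F}) \<le> (\<Sum>x\<in>G - U. real (card {F \<in> \<F>. insert x U \<subseteq> F}))"
      by (simp only: of_nat_sum[symmetric] of_nat_le_iff)
    also have "\<dots> \<le> (\<Sum>x\<in>G - U. \<epsilon> ^ j * w (insert x U))"
    proof (rule sum_mono)
      fix x assume "x \<in> G - U"
      then show "real (card {F \<in> \<F>. insert x U \<subseteq> F}) \<le> \<epsilon> ^ j * w (insert x U)"
        using Suc.prems G(1) sub finU by (intro Suc.IH) auto
    qed
    also have "\<dots> \<le> \<epsilon> ^ j * (w U / (2 * (real t + 1)))"
      unfolding sum_distrib_left[symmetric]
      using decay[OF Suc.prems(1) G(1)] \<epsilon> by (intro mult_left_mono) auto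
    finally show ?case by (simp add: \<epsilon>_def mult_ac)
  qed
  show ?thesis
  proof (cases "m = 0")
    case True
    have "S \<subseteq> F" if "F \<in> \<F>" for F
      using S that card_S True finS card_seteq[of S "S \<inter> F"] by (auto simp: cover_def)
    then show ?thesis using S card_S True by (auto simp: cover_def)
  next
    case False
    let ?\<T> = "{T. T \<subseteq> S \<and> card T = t}"
    have finT: "finite ?\<T>" using finS by simp
    have "\<F> \<subseteq> (\<Union>T\<in>?\<T>. {F \<in> \<F>. T \<subseteq> F})"
    proof
      fix F assume F: "F \<in> \<F>"
      then have "t \<le> card (S \<inter> F)" using S by (auto simp: cover_def)
      then obtain T where "T \<subseteq> S \<inter> F" "card T = t" by (meson obtain_subset_with_card_n)
      then show "F \<in> (\<Union>T\<in>?\<T>. {F \<in> \<F>. T \<subseteq> F})" using F by auto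
    qed
    then have "card \<F> \<le> card (\<Union>T\<in>?\<T>. {F \<in> \<F>. T \<subseteq> F})"
      using finT finF by (intro card_mono) auto
    also have "\<dots> \<le> (\<Sum>T\<in>?\<T>. card {F \<in> \<F>. T \<subseteq> F})"
      by (rule card_UN_le[OF finT])
    finally have "real (card \<F>) \<le> (\<Sum>T\<in>?\<T>. real (card {F \<in> \<F>. T \<subseteq> F}))"
      by (simp only: of_nat_sum[symmetric] of_nat_le_iff)
    also have "\<dots> \<le> (\<Sum>T\<in>?\<T>. \<epsilon> ^ m * M)"
    proof (rule sum_mono)
      fix T assume "T \<in> ?\<T>"
      then have T: "T \<subseteq> X" "card T = t" using S by (auto simp: cover_def)
      have "real (card {F \<in> \<F>. T \<subseteq> F}) \<le> \<epsilon> ^ m * w T" using shrink[OF T(1)] T card_S by simp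
      also have "\<dots> \<le> \<epsilon> ^ m * M" using bound[OF T] \<epsilon> by simp
      finally show "real (card {F \<in> \<F>. T \<subseteq> F}) \<le> \<epsilon> ^ m * M" .
    qed
    also have "\<dots> = real ((t + m) choose m) * \<epsilon> ^ m * M"
      using finS card_S binomial_symmetric[of m "t + m"] by (simp add: n_subsets)
    finally have le: "real (card \<F>) \<le> real ((t + m) choose m) * \<epsilon> ^ m * M" .
    \<comment> \<open>Needed to multiply the coefficient estimate by \<open>M\<close>; it follows
      from the bound just shown, since the family is nonempty.\<close>
    have "0 \<le> M"
    proof (rule ccontr)
      assume "\<not> 0 \<le> M"
      then have "real ((t + m) choose m) * \<epsilon> ^ m * M \<le> 0" using \<epsilon> by (intro mult_nonneg_nonpos) auto
      moreover have "0 < card \<F>" using ne finF by (simp add: card_gt_0_iff)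
      ultimately show False using le by simp
    qed
    have "real ((t + m) choose m) * \<epsilon> ^ m \<le> (real t + 1) ^ m * \<epsilon> ^ m"
      using \<epsilon> binomial_add_le_power[of t m]
      by (intro mult_right_mono) (auto simp flip: of_nat_le_iff[where ?'a = real] simp: add.commute)
    also have "\<dots> = ((real t + 1) * \<epsilon>) ^ m" by (simp only: power_mult_distrib)
    \<comment> \<open>The factor 2 in \<open>\<epsilon>\<close> is there for this: with
      \<open>m \<ge> 1\<close> the power is at most 1/2.\<close>
    also have "(real t + 1) * \<epsilon> = 1 / 2" by (simp add: \<epsilon>_def field_simps)
    also have "(1 / 2 :: real) ^ m \<le> 1 / 2"
      using False power_decreasing[of 1 m "1/2 :: real"] by simp
    finally have "real ((t + m) choose m) * \<epsilon> ^ m * M \<le> 1 / 2 * M"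
      using \<open>0 \<le> M\<close> by (rule mult_right_mono)
    with le show ?thesis by simp
  qed
qed

section \<open>Decay of star sizes under adding a point\<close>

lemma profile_insert:
  assumes "x \<in> block n i" "x \<notin> U"
  shows "profile n (insert x U) = (profile n U)(i := Suc (profile n U i))"
proof
  fix j
  have "x \<notin> block n j" if "j \<noteq> i"
    using disjoint_block[of n UNIV] that assms(1) by (auto simp: disjoint_family_on_def)
  then show "profile n (insert x U) j = ((profile n U)(i := Suc (profile n U i))) j"
    using assms by (cases "j = i") (auto simp: profile_def Int_insert_left)
qed

text \<open>The exact factor is the density at the profile of \<open>U\<close>, which is at most the
  density at 0.\<close>

lemma block_weight_insert_le:
  assumes "i \<in> {1..p}" "k i \<le> n i" "x \<in> block n i" "x \<notin> U"
  shows "real (block_weight p n k (profile n (insert x U)))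
    \<le> real (k i) / real (n i) * real (block_weight p n k (profile n U))"
proof -
  \<comment> \<open>Strict because \<open>x\<close> is a point of the block outside
    \<open>U\<close>.\<close>
  have "profile n U i < card (block n i)"
    unfolding profile_def using assms by (intro psubset_card_mono) auto
  then have less: "profile n U i < n i" using assms(1) by (simp add: card_block)
  have "density (n i) (k i) (profile n U i) \<le> density (n i) (k i) 0"
    by (rule density_antimono) (use assms less in auto)
  then have "density (n i) (k i) (profile n U i) \<le> real (k i) / real (n i)" by (simp add: density_def)
  then show ?thesis
    unfolding profile_insert[OF assms(3,4)] block_weight_increment[OF assms(1), of "profile n U" n k, OF less]
    by (rule mult_right_mono) simp
qed

text \<open>Block \<open>i\<close> offers at most \<open>k i\<close> points, each costing a factor
  \<open>k i / n i\<close>. The lower bound on \<open>n i\<close> makes the product at most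
  \<open>1 / (2 (t + 1) p)\<close>, and summing over the \<open>p\<close> blocks removes
  \<open>p\<close>.\<close>

lemma sum_block_weight_insert_le:
  assumes "1 \<le> p" and k: "\<And>i. i \<in> {1..p} \<Longrightarrow> k i \<le> n i"
    and large: "\<And>i. i \<in> {1..p} \<Longrightarrow> 2 * (t + 1) * p * (k i)\<^sup>2 < n i"
    and G: "G \<in> H1 p n k"
  shows "(\<Sum>x\<in>G - U. real (block_weight p n k (profile n (insert x U))))
    \<le> real (block_weight p n k (profile n U)) / (2 * (real t + 1))"
proof -
  let ?w = "\<lambda>U. real (block_weight p n k (profile n U))"
  have Gp: "G \<subseteq> ground p n" "\<And>i. i \<in> {1..p} \<Longrightarrow> card (G \<inter> block n i) = k i"
    using G by (auto simp: H1_eq)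
  have "G - U = (\<Union>i\<in>{1..p}. (G - U) \<inter> block n i)"
    using Gp(1) by (auto simp: ground_eq_Union_block)
  then have "(\<Sum>x\<in>G - U. ?w (insert x U)) = (\<Sum>x\<in>(\<Union>i\<in>{1..p}. (G - U) \<inter> block n i). ?w (insert x U))"
    by simp
  also have "\<dots> = (\<Sum>i=1..p. \<Sum>x\<in>(G - U) \<inter> block n i. ?w (insert x U))"
    using disjoint_block[of n "{1..p}"]
    by (intro sum.UNION_disjoint) (auto simp: disjoint_family_on_def)
  also have "\<dots> \<le> (\<Sum>i=1..p. ?w U / (2 * (real t + 1) * real p))"
  proof (rule sum_mono)
    fix i assume i: "i \<in> {1..p}"
    have "(\<Sum>x\<in>(G - U) \<inter> block n i. ?w (insert x U))
        \<le> real (card ((G - U) \<inter> block n i)) * (real (k i) / real (n i) * ?w U)"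
      using block_weight_insert_le[of i p k n, OF i k[OF i]] by (intro sum_bounded_above) auto
    also have "\<dots> \<le> real (k i) * (real (k i) / real (n i) * ?w U)"
      using card_mono[of "G \<inter> block n i" "(G - U) \<inter> block n i"] Gp(2)[OF i]
      by (intro mult_right_mono) auto
    also have "\<dots> = ((real (k i))\<^sup>2 / real (n i)) * ?w U" by (simp add: power2_eq_square)
    also have "\<dots> \<le> (1 / (2 * (real t + 1) * real p)) * ?w U"
    proof (rule mult_right_mono)
      define c where "c = 2 * (real t + 1) * real p"
      have "real (2 * (t + 1) * p * (k i)\<^sup>2) \<le> real (n i)"
        using less_imp_le[OF large[OF i]] by (simp only: of_nat_le_iff)
      then have "c * (real (k i))\<^sup>2 \<le> real (n i)" by (simp add: c_def algebra_simps)
      moreover have "0 < n i" using large[OF i] by simp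
      moreover have "0 < c" using assms(1) by (simp add: c_def)
      ultimately show "(real (k i))\<^sup>2 / real (n i) \<le> 1 / (2 * (real t + 1) * real p)"
        unfolding c_def[symmetric] by (simp add: divide_simps mult.commute)
    qed simp
    finally show "(\<Sum>x\<in>(G - U) \<inter> block n i. ?w (insert x U)) \<le> ?w U / (2 * (real t + 1) * real p)"
      by simp
  qed
  also have "\<dots> = ?w U / (2 * (real t + 1))" using assms(1) by simp
  finally show ?thesis .
qed

section \<open>From compositions back to sets, and the final assembly\<close>

lemma profile_surj:
  assumes "\<And>i. i \<in> {1..p} \<Longrightarrow> \<tau> i \<le> n i"
  obtains T where "T \<subseteq> ground p n" "\<And>i. i \<in> {1..p} \<Longrightarrow> profile n T i = \<tau> i"
proof -
  have "\<forall>i\<in>{1..p}. \<exists>A. A \<subseteq> block n i \<and> card A = \<tau> i"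
    using assms by (metis atLeastAtMost_iff card_block obtain_subset_with_card_n)
  then obtain A where A: "\<And>i. i \<in> {1..p} \<Longrightarrow> A i \<subseteq> block n i \<and> card (A i) = \<tau> i" by metis
  have "(\<Union>j\<in>{1..p}. A j) \<inter> block n i = A i" if "i \<in> {1..p}" for i
    using A that by (intro Union_Int_disjoint_family[OF disjoint_block]) auto
  then show thesis
    using A by (intro that[of "\<Union>j\<in>{1..p}. A j"]) (force simp: profile_def ground_eq_Union_block)+
qed

text \<open>Evaluating the density at \<open>s - 1\<close> produces the two \<open>+ 1\<close> terms
  of the stated inequality.\<close>

lemma balanced_profile_iff:
  "balanced p n k (profile n T) \<longleftrightarrow>
    (\<forall>i\<in>{1..p}. \<forall>j\<in>{1..p}. card (T \<inter> block n j) \<ge> 1 \<longrightarrow>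
      (real (k i) - real (card (T \<inter> block n i))) / (real (n i) - real (card (T \<inter> block n i)))
      \<le> (real (k j) - real (card (T \<inter> block n j)) + 1)
         / (real (n j) - real (card (T \<inter> block n j)) + 1))"
proof -
  have "density (n j) (k j) (s - 1) = (real (k j) - real s + 1) / (real (n j) - real s + 1)"
    if "1 \<le> s" for j s
    using that by (simp add: density_def of_nat_diff algebra_simps)
  then show ?thesis by (auto simp: balanced_def profile_def density_def[of _ _ "card _"])
qed

theorem theorem1p2:
  fixes p t :: nat and n k :: "nat \<Rightarrow> nat" and \<F> :: "nat set set"
  assumes "p \<ge> 1" and "t \<ge> 1"
    and "\<forall>i\<in>{1..p}. 1 \<le> n i \<and> 1 \<le> k i \<and> k i \<le> n i"
    and "\<F> \<subseteq> H1 p n k"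
    and "t_intersecting t \<F>"
    and "\<forall>i\<in>{1..p}. n i > 2 * (t + 1) * p * (k i)\<^sup>2"
  shows "card \<F> \<le> max_bound p t n k \<and>
    (card \<F> = max_bound p t n k \<longleftrightarrow>
      (\<exists>T \<in> nsets (ground p n) t.
         \<F> = {F \<in> H1 p n k. T \<subseteq> F} \<and>
         (\<forall>i\<in>{1..p}. \<forall>j\<in>{1..p}. card (T \<inter> block n j) \<ge> 1 \<longrightarrow>
            (real (k i) - real (card (T \<inter> block n i))) / (real (n i) - real (card (T \<inter> block n i)))
            \<le> (real (k j) - real (card (T \<inter> block n j)) + 1)
               / (real (n j) - real (card (T \<inter> block n j)) + 1))))"
proof -
  let ?M = "max_bound p t n k"
  have kn: "k i \<le> n i" if "i \<in> {1..p}" for i using assms(3) that by blast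
  \<comment> \<open>Keeps every composition of \<open>t\<close> strictly below \<open>n i\<close>,
    where the densities have positive denominators.\<close>
  have tn: "t < n i" if i: "i \<in> {1..p}" for i
  proof -
    have "1 \<le> k i" using assms(3) i by blast
    then have "1 * (t + 1) * 1 * 1 \<le> 2 * (t + 1) * p * (k i)\<^sup>2"
      using assms(1) by (intro mult_le_mono) auto
    also have "\<dots> < n i" using assms(6) i by blast
    finally show ?thesis by simp
  qed
  have finF: "finite \<F>" using assms(4) finite_H1 finite_subset by blast
  have star_le: "card {F \<in> H1 p n k. T \<subseteq> F} \<le> ?M" if "T \<subseteq> ground p n" "card T = t" for T
    using that block_weight_le_max_bound[OF sum_profile[OF that(1)]] by (simp add: card_star)
  have star_eq: "card {F \<in> H1 p n k. T \<subseteq> F} = ?M"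
    if T: "T \<subseteq> ground p n" "card T = t" "balanced p n k (profile n T)" for T
  proof -
    have sum: "(\<Sum>i=1..p. profile n T i) = t" using sum_profile[OF T(1)] T(2) by simp
    then obtain \<sigma> where \<sigma>: "(\<Sum>i=1..p. \<sigma> i) = t" "?M = block_weight p n k \<sigma>"
      using max_bound_attained by blast
    have "?M \<le> block_weight p n k (profile n T)"
      unfolding \<sigma>(2) using balanced_block_weight_max[where n = n and k = k, OF assms(1) kn tn sum T(3) \<sigma>(1)] by blast
    then show ?thesis using star_le[OF T(1,2)] T(1) by (simp add: card_star)
  qed
  have main: "card \<F> \<le> ?M \<and> (card \<F> = ?M \<longrightarrow>
      (\<exists>T. T \<subseteq> ground p n \<and> card T = t \<and> \<F> = {F \<in> H1 p n k. T \<subseteq> F} \<and> balanced p n k (profile n T)))"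
  proof (cases "\<F> = {}")
    case True
    \<comment> \<open>Equality here means that the bound is 0, i.e. \<open>t\<close> exceeds the sum of the \<open>k i\<close>.\<close>
    obtain \<tau> where \<tau>: "(\<Sum>i=1..p. \<tau> i) = t" "balanced p n k \<tau>"
      using balanced_exists[where n = n and k = k, OF assms(1) kn tn] by blast
    have "\<tau> i \<le> n i" if "i \<in> {1..p}" for i
      using member_le_sum[of i "{1..p}" \<tau>] \<tau>(1) tn[OF that] that by auto
    then obtain T where T: "T \<subseteq> ground p n" "\<And>i. i \<in> {1..p} \<Longrightarrow> profile n T i = \<tau> i"
      using profile_surj by blast
    have cT: "card T = t" using T \<tau>(1) sum_profile[of T p n] by simp
    have bal: "balanced p n k (profile n T)" using \<tau>(2) T(2) by (simp add: balanced_def)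
    have "finite {F \<in> H1 p n k. T \<subseteq> F}" by simp
    \<comment> \<open>The star of \<open>T\<close> has size \<open>?M = 0\<close>, so it is empty
      like \<open>\<F>\<close>.\<close>
    then have "\<F> = {F \<in> H1 p n k. T \<subseteq> F}" if "card \<F> = ?M"
      using star_eq[OF T(1) cT bal] that True by (metis card.empty card_eq_0_iff)
    then show ?thesis using True T(1) cT bal by auto
  next
    case False
    then have pos: "0 < card \<F>" using finF by (simp add: card_gt_0_iff)
    have "(\<exists>T\<subseteq>ground p n. card T = t \<and> (\<forall>F\<in>\<F>. T \<subseteq> F)) \<or> real (card \<F>) \<le> real ?M / 2"
    proof (rule t_intersecting_trivial_or_small[where w = "\<lambda>U. real (block_weight p n k (profile n U))"])
      show "\<F> \<subseteq> Pow (ground p n)" using assms(4) by (auto simp: H1_eq)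
    next
      fix U assume U: "U \<subseteq> ground p n"
      have "card {F \<in> \<F>. U \<subseteq> F} \<le> card {F \<in> H1 p n k. U \<subseteq> F}"
        using assms(4) by (intro card_mono) auto
      then show "real (card {F \<in> \<F>. U \<subseteq> F}) \<le> real (block_weight p n k (profile n U))"
        using U by (simp add: card_star)
    next
      fix U G assume "U \<subseteq> ground p n" "G \<in> \<F>"
      then show "(\<Sum>x\<in>G - U. real (block_weight p n k (profile n (insert x U))))
          \<le> real (block_weight p n k (profile n U)) / (2 * (real t + 1))"
        using assms by (intro sum_block_weight_insert_le) auto
    next
      fix T assume "T \<subseteq> ground p n" "card T = t"
      then show "real (block_weight p n k (profile n T)) \<le> real ?M"
        using star_le by (simp add: card_star)
    qed (use False assms(5) in auto)
    then show ?thesis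
    proof
      assume "real (card \<F>) \<le> real ?M / 2"
      \<comment> \<open>Since \<open>card \<F> > 0\<close>, the bound is strict and equality is
        impossible.\<close>
      then show ?thesis using pos by auto
    next
      assume "\<exists>T\<subseteq>ground p n. card T = t \<and> (\<forall>F\<in>\<F>. T \<subseteq> F)"
      then obtain T where T: "T \<subseteq> ground p n" "card T = t" "\<And>F. F \<in> \<F> \<Longrightarrow> T \<subseteq> F" by blast
      have sub: "\<F> \<subseteq> {F \<in> H1 p n k. T \<subseteq> F}" using T(3) assms(4) by auto
      then have le: "card \<F> \<le> card {F \<in> H1 p n k. T \<subseteq> F}" by (intro card_mono) auto
      have "\<F> = {F \<in> H1 p n k. T \<subseteq> F} \<and> balanced p n k (profile n T)" if eq: "card \<F> = ?M"
      proof
        \<comment> \<open>The star size lies between \<open>card \<F> = ?M\<close> and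
          \<open>?M\<close>; hence \<open>\<F>\<close> fills the star, and the profile of
          \<open>T\<close> is optimal with positive weight.\<close>
        have cs: "card {F \<in> H1 p n k. T \<subseteq> F} = ?M" using le star_le[OF T(1,2)] eq by simp
        show "\<F> = {F \<in> H1 p n k. T \<subseteq> F}"
          using sub cs eq by (intro card_subset_eq) auto
        have bw: "block_weight p n k (profile n T) = ?M" using cs T(1) by (simp add: card_star)
        show "balanced p n k (profile n T)"
        proof (rule block_weight_max_balanced[where n = n and k = k, OF kn tn])
          show "(\<Sum>i=1..p. profile n T i) = t" using sum_profile[OF T(1)] T(2) by simp
        qed (use bw eq pos in \<open>auto simp: block_weight_le_max_bound\<close>)
      qed
      then show ?thesis using le star_le[OF T(1,2)] T(1,2) by auto
    qed
  qed
  have nsets: "T \<in> nsets (ground p n) t \<longleftrightarrow> T \<subseteq> ground p n \<and> card T = t" for T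
    by (auto simp: nsets_def intro: finite_subset[OF _ finite_ground])
  show ?thesis
    unfolding balanced_profile_iff[symmetric] Bex_def nsets
    using main star_eq by blast
qed

end
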